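(* Let $H_n^{(3)}=\sum_{j=1}^n \frac{1}{j^3}$ (so $H_0^{(3)}=0$) and $(x)_k=x(x+1)\cdots(x+k-1)$ (with $(x)_0=1$). Then \[ \sum_{k=0}^{\infty}\Big(\frac{-1}{1024}\Big)^k\frac{(\frac{1}{2})_k^5}{(1)_k^5}\bigg\{(820k^2+180k+13)\Big[9H_{2k}^{(3)}-H_{k}^{(3)}\Big]+\frac{125}{2k+1}\bigg\} =\frac{1024\zeta(3)}{\pi^2}, \] where $\zeta(3)=\sum_{k=1}^\infty k^{-3}$.
   Context: $(x)_k$ denotes the rising factorial (shifted factorial). $H_n^{(3)}$ is the harmonic number of order 3. *)

theory Defs
  imports "HOL-Analysis.Analysis"
begin

definition gen_harm :: "nat \<Rightarrow> nat \<Rightarrow> real" where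
  "gen_harm r n = (\<Sum>j=1..n. 1 / real j ^ r)"

(* The series over k >= 1, reindexed to start at 0.  For s <= 1 it diverges and
   the value is meaningless. *)
definition zeta_nat :: "nat \<Rightarrow> real" where
  "zeta_nat s = (\<Sum>k. 1 / real (Suc k) ^ s)"

end

theory Submission
  imports Defs "HOL-Real_Asymp.Real_Asymp"
begin

text \<open>
  For a parameter \<open>t\<close> consider the hypergeometric term \<open>T(n,k;t)\<close> given by
  \<open>(-1)^n (1/2)_(n+k) (\<Prod>j<n+k. (j+1/2)^3 + t) (\<Prod>j<n. (j+1/2)^6 - t^2) /
   ((2n+k)! (\<Prod>j=1..2n+k. j^3 - t) (2n)!)\<close>.
  It is the term behind the acceleration \<open>a \<mapsto> a+3\<close>, \<open>b,c,d,e \<mapsto> b+1,c+1,d+1,e+1\<close> of Dougall's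
  well-poised series at \<open>a = e = 1/2\<close>, with \<open>b, c, d\<close> equal to \<open>1/2\<close> plus the three cube roots
  of \<open>t\<close>, and it carries a Wilf-Zeilberger pair.  The pair \<open>F\<close>, \<open>G\<close> below is the coefficient
  of \<open>t\<close> at \<open>t = 0\<close> of that pair; the harmonic numbers are the logarithmic derivative of
  the term.  As \<open>F(0,k) = 0\<close>, the sum of \<open>G(n,k)\<close> over \<open>n\<close> does not depend on \<open>k\<close>.  At \<open>k = 0\<close> it is
  the series in question, and as \<open>k \<rightarrow> \<infinity>\<close> only \<open>n = 0\<close> survives, whose limit is given by the
  asymptotics of \<open>(1/2)_k / k!\<close> and \<open>8 H_(2k) \<rightarrow> 8 \<zeta>(3)\<close>.
\<close>

section \<open>The Wilf-Zeilberger pair\<close>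

definition wz_term :: "nat \<Rightarrow> nat \<Rightarrow> real" where
  "wz_term n k = (-1) ^ n * pochhammer (1/2) (n + k) ^ 4 * pochhammer (1/2) n ^ 6 /
                 (fact (2 * n + k) ^ 4 * fact (2 * n))"

text \<open>\<open>d/dt log T\<close> at \<open>t = 0\<close>, where \<open>T = wz_term n k\<close>.
  With \<open>m = n + k\<close>, the odd sum \<open>\<Sum>j<m. 8 / (2j+1)^3\<close> equals
  \<open>8 H_(2m) - H_m\<close>; the factors \<open>j^3 - t\<close> of the denominator give the last
  summand.\<close>

definition wz_harm :: "nat \<Rightarrow> nat \<Rightarrow> real" where
  "wz_harm n k = 8 * gen_harm 3 (2 * (n + k)) - gen_harm 3 (n + k) + gen_harm 3 (2 * n + k)"

text \<open>
  The certificate is \<open>cert0 + t * cert1\<close> modulo \<open>t\<^sup>2\<close>, in the variables \<open>u = 2n+1\<close> and \<open>q = 2n+k+1\<close>, in which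
  a step in \<open>k\<close> is \<open>q \<mapsto> q+1\<close>; all is scaled by 128 so that \<open>cert0 u u = 820 n\<^sup>2 + 180 n + 13\<close>.
\<close>

definition cert0 :: "real \<Rightarrow> real \<Rightarrow> real" where
  "cert0 u q = 16 * (8 * (q - 1)^2 + 4 * u * (q - 1) + u^2) - u^5 * (4 * q - u) / q^4"

definition cert1 :: "real \<Rightarrow> real \<Rightarrow> real" where
  "cert1 u q = 128 / u - u^5 * (4 * q - u) / q^7"

text \<open>Modulo \<open>t^2\<close> the cofactor of \<open>T\<close> in \<open>F\<close> is free
  of \<open>t\<close>, so only \<open>wz_harm\<close> appears here, whereas the product rule adds
  \<open>cert1\<close> in \<open>wz_G\<close>.\<close>

definition wz_F :: "nat \<Rightarrow> nat \<Rightarrow> real" where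
  "wz_F n k = (let u = 2 * real n + 1; q = 2 * real n + real k + 1
               in wz_term n k * (64 * (u - 1) * (4 * q - u - 2)) * wz_harm n k)"

definition wz_G :: "nat \<Rightarrow> nat \<Rightarrow> real" where
  "wz_G n k = (let u = 2 * real n + 1; q = 2 * real n + real k + 1
               in wz_term n k * (cert0 u q * wz_harm n k + cert1 u q))"

section \<open>Recurrences of the term and of its logarithmic derivative\<close>

lemma gen_harm_Suc: "gen_harm r (Suc n) = gen_harm r n + 1 / real (Suc n) ^ r"
  by (simp add: gen_harm_def)

lemma wz_term_Suc_right:
  "wz_term n (Suc k) =
     wz_term n k * ((2 * real n + 2 * real k + 1) ^ 4 / (16 * (2 * real n + real k + 1) ^ 4))"
proof -
  have p: "pochhammer (1/2) (Suc (n + k)) = pochhammer (1/2) (n + k) * ((2 * real n + 2 * real k + 1) / 2)"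
    by (simp add: pochhammer_Suc field_simps)
  have f: "fact (Suc (2 * n + k)) = (2 * real n + real k + 1) * fact (2 * n + k)"
    by simp
  show ?thesis
    unfolding wz_term_def add_Suc_right p f
    by (simp add: power_mult_distrib power_divide mult_ac)
qed

lemma wz_term_Suc_left:
  fixes n k :: nat
  defines "u \<equiv> 2 * real n + 1" and "q \<equiv> 2 * real n + real k + 1"
  shows "wz_term (Suc n) k =
     - wz_term n k * ((2 * q - u) ^ 4 * u ^ 5 / (1024 * q ^ 4 * (q + 1) ^ 4 * (u + 1)))"
proof -
  have u: "u > 0" and q: "q > 0" by (simp_all add: u_def q_def)
  have p: "pochhammer (1/2) (Suc (n + k)) = pochhammer (1/2) (n + k) * ((2 * q - u) / 2)"
    by (simp add: pochhammer_Suc u_def q_def field_simps)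
  have p': "pochhammer (1/2) (Suc n) = pochhammer (1/2) n * (u / 2)"
    by (simp add: pochhammer_Suc u_def field_simps)
  have f: "fact (Suc (Suc (2 * n + k))) = (q + 1) * (q * fact (2 * n + k))"
    by (simp add: q_def algebra_simps)
  have f': "fact (Suc (Suc (2 * n))) = (u + 1) * (u * fact (2 * n))"
    by (simp add: u_def algebra_simps)
  have e: "Suc n + k = Suc (n + k)" "2 * Suc n + k = Suc (Suc (2 * n + k))"
    "2 * Suc n = Suc (Suc (2 * n))" by simp_all
  have u6: "u ^ 6 = u ^ 5 * u" by (simp add: eval_nat_numeral)
  show ?thesis
    unfolding wz_term_def e(1,2) unfolding e(3) p p' f f' using u q
    by (simp add: power_mult_distrib power_divide u6 mult_ac)
qed

lemma wz_harm_Suc_right: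
  fixes n k :: nat
  defines "u \<equiv> 2 * real n + 1" and "q \<equiv> 2 * real n + real k + 1"
  shows "wz_harm n (Suc k) = wz_harm n k + (8 / (2 * q - u) ^ 3 + 1 / q ^ 3)"
proof -
  \<comment> \<open>The even-index term entering \<open>8 H_(2(n+k))\<close> cancels the one
    entering \<open>H_(n+k)\<close>; only the odd index \<open>2(n+k)+1 = 2q - u\<close>
    survives.\<close>
  have h: "8 * (1 / real (2 * Suc (n + k)) ^ 3) = 1 / real (Suc (n + k)) ^ 3"
    by (simp only: of_nat_mult power_mult_distrib) simp
  have e: "2 * (n + Suc k) = Suc (Suc (2 * (n + k)))" by simp
  have e': "2 * Suc (n + k) = Suc (Suc (2 * (n + k)))" by simp
  have p: "2 * q - u = real (Suc (2 * (n + k)))" and q: "q = real (Suc (2 * n + k))"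
    by (simp_all add: u_def q_def)
  show ?thesis
    using h unfolding wz_harm_def e e' p unfolding q add_Suc_right gen_harm_Suc by simp
qed

text \<open>Raising \<open>n\<close> acts on \<open>n + k\<close> as raising \<open>k\<close> does,
  but moves \<open>2n + k\<close> one place further.\<close>

lemma wz_harm_Suc_left:
  fixes n k :: nat
  defines "u \<equiv> 2 * real n + 1" and "q \<equiv> 2 * real n + real k + 1"
  shows "wz_harm (Suc n) k = wz_harm n k + (8 / (2 * q - u) ^ 3 + 1 / q ^ 3 + 1 / (q + 1) ^ 3)"
proof -
  have "wz_harm (Suc n) k = wz_harm n (Suc k) + 1 / (q + 1) ^ 3"
    by (simp add: wz_harm_def gen_harm_Suc q_def algebra_simps)
  then show ?thesis
    unfolding u_def q_def wz_harm_Suc_right by simp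
qed

section \<open>The Wilf-Zeilberger equation\<close>

text \<open>The equation at \<open>t = 0\<close>, divided by \<open>wz_term n k\<close>. The term of
  the shifted \<open>F\<close> equals \<open>s * w\<close>, with \<open>w\<close> the fraction in
  \<open>cert0 u (q + 1)\<close>; it cancels, leaving a polynomial identity over
  \<open>q^4\<close>.\<close>

lemma cert0_step:
  assumes "q > 0"
  shows "64 * (u - 1) * (4 * q - u - 2) + (2 * q - u) ^ 4 * u ^ 5 * (4 * q - u + 4) / (16 * q ^ 4 * (q + 1) ^ 4) =
         cert0 u q - (2 * q - u) ^ 4 / (16 * q ^ 4) * cert0 u (q + 1)"
proof -
  define B where "B = 8 * (q - 1)^2 + 4 * u * (q - 1) + u^2"
  define C where "C = 8 * q^2 + 4 * u * q + u^2"
  define s where "s = (2 * q - u) ^ 4 / (16 * q ^ 4)"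
  define w where "w = u ^ 5 * (4 * q - u + 4) / (q + 1) ^ 4"
  have "q ^ 4 * (16 * B - 64 * (u - 1) * (4 * q - u - 2)) = u ^ 5 * (4 * q - u) + (2 * q - u) ^ 4 * C"
    unfolding B_def C_def by algebra
  then have "16 * B - 64 * (u - 1) * (4 * q - u - 2) = u ^ 5 * (4 * q - u) / q ^ 4 + 16 * (s * C)"
    using assms by (simp add: s_def field_simps)
  moreover have "4 * (q + 1) - u = 4 * q - u + 4" by simp
  then have "cert0 u (q + 1) = 16 * C - w"
    by (simp add: cert0_def C_def w_def)
  moreover have "cert0 u q = 16 * B - u ^ 5 * (4 * q - u) / q ^ 4"
    by (simp add: cert0_def B_def)
  ultimately have "64 * (u - 1) * (4 * q - u - 2) + s * w = cert0 u q - s * cert0 u (q + 1)"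
    by (simp only: right_diff_distrib)
  moreover have "(2 * q - u) ^ 4 * u ^ 5 * (4 * q - u + 4) / (16 * q ^ 4 * (q + 1) ^ 4) = s * w"
    by (simp add: s_def w_def)
  ultimately show ?thesis
    by (simp add: s_def)
qed

text \<open>The coefficient of \<open>t\<close>, less \<open>wz_harm n k\<close> times
  \<open>cert0_step\<close>. The sums of inverse cubes are the increments of \<open>wz_harm\<close>
  in \<open>n\<close> and in \<open>k\<close>; the fractions in \<open>q + 1\<close> cancel
  again.\<close>

lemma cert1_step:
  assumes "q > 0" "u > 0" "2 * q - u > 0"
  shows "(2 * q - u) ^ 4 * u ^ 5 * (4 * q - u + 4) / (16 * q ^ 4 * (q + 1) ^ 4) *
           (8 / (2 * q - u) ^ 3 + 1 / q ^ 3 + 1 / (q + 1) ^ 3) =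
         cert1 u q - (2 * q - u) ^ 4 / (16 * q ^ 4) *
           (cert1 u (q + 1) + cert0 u (q + 1) * (8 / (2 * q - u) ^ 3 + 1 / q ^ 3))"
proof -
  define p where "p = 2 * q - u"
  define s where "s = p ^ 4 / (16 * q ^ 4)"
  define w where "w = u ^ 5 * (4 * q - u + 4) / (q + 1) ^ 4"
  define X where "X = 8 / p ^ 3 + 1 / q ^ 3"
  define C where "C = 8 * q^2 + 4 * u * q + u^2"
  have p: "p > 0" using assms by (simp add: p_def)
  have 4: "4 * (q + 1) - u = 4 * q - u + 4" by simp
  have c0: "cert0 u (q + 1) = 16 * C - w"
    by (simp add: cert0_def w_def C_def 4)
  have "(q + 1) ^ 7 = (q + 1) ^ 4 * (q + 1) ^ 3"
    by (simp flip: power_add)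
  then have c1: "cert1 u (q + 1) = 128 / u - w / (q + 1) ^ 3"
    by (simp add: cert1_def w_def 4)
  have sX: "16 * (s * X) = (8 * p * q ^ 3 + p ^ 4) / q ^ 7"
    using p assms by (simp add: s_def X_def field_simps eval_nat_numeral)
  \<comment> \<open>The next claim multiplied by \<open>u * q^7\<close>.\<close>
  have "128 * q ^ 7 - u ^ 6 * (4 * q - u) = 8 * q ^ 3 * p ^ 4 + u * C * (8 * p * q ^ 3 + p ^ 4)"
    unfolding p_def C_def by algebra
  then have "cert1 u q = s * (128 / u) + C * (16 * (s * X))"
    unfolding sX unfolding cert1_def s_def using assms
    by (simp add: field_simps eval_nat_numeral)
  then have "s * w * (X + 1 / (q + 1) ^ 3) = cert1 u q - s * (cert1 u (q + 1) + cert0 u (q + 1) * X)"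
    unfolding c0 c1 by (simp add: algebra_simps)
  moreover have "p ^ 4 * u ^ 5 * (4 * q - u + 4) / (16 * q ^ 4 * (q + 1) ^ 4) = s * w"
    by (simp add: s_def w_def)
  ultimately show ?thesis
    unfolding p_def [symmetric] X_def [symmetric] s_def [symmetric] by simp
qed

text \<open>Divided by \<open>wz_term n k\<close>, both sides are affine in
  \<open>wz_harm n k\<close>: \<open>cert0_step\<close> matches the slopes,
  \<open>cert1_step\<close> the constants.\<close>

lemma wz_pair: "wz_F n k - wz_F (Suc n) k = wz_G n k - wz_G n (Suc k)"
proof -
  define u where "u = 2 * real n + 1"
  define q where "q = 2 * real n + real k + 1"
  define p where "p = 2 * q - u"
  define X where "X = 8 / p ^ 3 + 1 / q ^ 3"
  define s where "s = p ^ 4 / (16 * q ^ 4)"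
  define w where "w = p ^ 4 * u ^ 5 * (4 * q - u + 4) / (16 * q ^ 4 * (q + 1) ^ 4)"
  define T where "T = wz_term n k"
  define L where "L = wz_harm n k"
  have pos: "u > 0" "q > 0" "p > 0" by (simp_all add: u_def q_def p_def)
  have "wz_F (Suc n) k = - T * w * (L + (X + 1 / (q + 1) ^ 3))"
  proof -
    have "2 * real (Suc n) + 1 - 1 = u + 1"
      "4 * (2 * real (Suc n) + real k + 1) - (2 * real (Suc n) + 1) - 2 = 4 * q - u + 4"
      by (simp_all add: u_def q_def)
    then have "wz_F (Suc n) k = wz_term (Suc n) k * (64 * (u + 1) * (4 * q - u + 4)) * wz_harm (Suc n) k"
      unfolding wz_F_def Let_def by (simp only:)
    also have "wz_term (Suc n) k = - T * (p ^ 4 * u ^ 5 / (1024 * q ^ 4 * (q + 1) ^ 4 * (u + 1)))"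
      unfolding wz_term_Suc_left T_def p_def u_def q_def ..
    also have "- T * (p ^ 4 * u ^ 5 / (1024 * q ^ 4 * (q + 1) ^ 4 * (u + 1))) * (64 * (u + 1) * (4 * q - u + 4)) = - T * w"
      using pos by (simp add: w_def divide_simps) (simp add: algebra_simps)
    finally show ?thesis
      unfolding wz_harm_Suc_left X_def L_def p_def u_def q_def .
  qed
  moreover have "wz_G n (Suc k) = T * s * (cert0 u (q + 1) * (L + X) + cert1 u (q + 1))"
  proof -
    have "2 * real n + real (Suc k) + 1 = q + 1" by (simp add: q_def)
    moreover have "wz_term n (Suc k) = T * s"
      unfolding wz_term_Suc_right s_def T_def p_def u_def q_def by (simp add: algebra_simps)
    moreover have "wz_harm n (Suc k) = L + X"
      unfolding wz_harm_Suc_right X_def L_def p_def u_def q_def ..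
    ultimately show ?thesis
      unfolding wz_G_def Let_def u_def by (simp only:)
  qed
  moreover have "wz_F n k = T * (64 * (u - 1) * (4 * q - u - 2)) * L"
    by (simp add: wz_F_def Let_def T_def L_def u_def q_def)
  moreover have "wz_G n k = T * (cert0 u q * L + cert1 u q)"
    by (simp add: wz_G_def Let_def T_def L_def u_def q_def)
  moreover have "64 * (u - 1) * (4 * q - u - 2) + w = cert0 u q - s * cert0 u (q + 1)"
    using cert0_step[of q u] pos by (simp add: w_def s_def p_def)
  moreover have "w * (X + 1 / (q + 1) ^ 3) = cert1 u q - s * (cert1 u (q + 1) + cert0 u (q + 1) * X)"
    using cert1_step[of q u] pos by (simp add: w_def s_def p_def X_def)
  ultimately show ?thesis
    by algebra
qed


section \<open>Bounds uniform in k\<close>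

lemma gen_harm_nonneg: "gen_harm r n \<ge> 0"
  by (simp add: gen_harm_def sum_nonneg)

lemma gen_harm_tendsto_zeta_nat:
  assumes "s \<ge> 2"
  shows "gen_harm s \<longlonglongrightarrow> zeta_nat s"
proof -
  have eq: "gen_harm s n = (\<Sum>k<n. 1 / real (Suc k) ^ s)" for n
    by (induction n) (simp_all add: gen_harm_Suc, simp add: gen_harm_def)
  have "summable (\<lambda>n. inverse (real n ^ s))"
    using assms by (simp add: inverse_power_summable)
  then have "summable (\<lambda>k. 1 / real (Suc k) ^ s)"
    by (subst (asm) summable_Suc_iff [symmetric]) (simp add: inverse_eq_divide)
  then show ?thesis
    unfolding zeta_nat_def eq [abs_def] by (rule summable_LIMSEQ)
qed

lemma gen_harm_le_zeta_nat:
  assumes "s \<ge> 2"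
  shows "gen_harm s n \<le> zeta_nat s"
  by (rule incseq_le [OF incseq_SucI gen_harm_tendsto_zeta_nat [OF assms]]) (simp add: gen_harm_Suc)

lemma abs_wz_harm_le: "\<bar>wz_harm n k\<bar> \<le> 9 * zeta_nat 3"
  using gen_harm_nonneg[of 3 "2 * (n + k)"] gen_harm_nonneg[of 3 "n + k"] gen_harm_nonneg[of 3 "2 * n + k"]
    gen_harm_le_zeta_nat[of 3 "2 * (n + k)"] gen_harm_le_zeta_nat[of 3 "n + k"]
    gen_harm_le_zeta_nat[of 3 "2 * n + k"]
  unfolding wz_harm_def by simp

lemma wz_harm_0_tendsto: "wz_harm 0 \<longlonglongrightarrow> 8 * zeta_nat 3"
proof -
  have H: "gen_harm 3 \<longlonglongrightarrow> zeta_nat 3"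
    by (rule gen_harm_tendsto_zeta_nat) simp
  have "(\<lambda>k. gen_harm 3 (2 * k)) \<longlonglongrightarrow> zeta_nat 3"
    using LIMSEQ_subseq_LIMSEQ[OF H, of "\<lambda>k. 2 * k"] by (simp add: strict_mono_def o_def)
  then have "(\<lambda>k. 8 * gen_harm 3 (2 * k) - gen_harm 3 k + gen_harm 3 k) \<longlonglongrightarrow> 8 * zeta_nat 3 - zeta_nat 3 + zeta_nat 3"
    by (intro tendsto_intros H)
  then show ?thesis
    by (simp add: wz_harm_def [abs_def])
qed

lemma abs_cert0_le:
  assumes "1 \<le> u" "u \<le> q"
  shows "\<bar>cert0 u q\<bar> \<le> 256 * q^2"
proof -
  have q: "q > 0" using assms by simp
  have "u ^ 5 * (4 * q - u) \<le> q ^ 5 * (4 * q)"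
    using assms by (intro mult_mono power_mono) auto
  also have "\<dots> = (4 * q^2) * q ^ 4"
    by (simp add: eval_nat_numeral)
  finally have t: "u ^ 5 * (4 * q - u) / q ^ 4 \<le> 4 * q^2"
    using q by (simp add: divide_le_eq)
  have t0: "0 \<le> u ^ 5 * (4 * q - u) / q ^ 4"
    using assms by (intro divide_nonneg_nonneg mult_nonneg_nonneg) auto
  have abc: "(q - 1)^2 \<le> q^2" "u^2 \<le> q^2" "u * (q - 1) \<le> q^2" "0 \<le> u * (q - 1)"
    using assms by (auto simp: power2_eq_square intro!: mult_mono)
  \<comment> \<open>The bracket lies between 0 and \<open>16 * (8 + 4 + 1) * d = 208 * d\<close>, so
    256 is generous; it equals the \<open>64 * 4\<close> met in bounding
    \<open>wz_F\<close>.\<close>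
  have "\<bar>16 * (8 * a + 4 * b + c) - t\<bar> \<le> 256 * d"
    if "t \<le> 4 * d" "0 \<le> t" "a \<le> d" "c \<le> d" "b \<le> d" "0 \<le> b" "0 \<le> a" "0 \<le> c" for a b c d t :: real
    using that by (auto simp: abs_le_iff)
  from this[OF t t0 abc zero_le_power2 zero_le_power2] show ?thesis
    by (simp only: cert0_def mult.assoc)
qed

lemma abs_cert1_le:
  assumes "1 \<le> u" "u \<le> q"
  shows "\<bar>cert1 u q\<bar> \<le> 128"
proof -
  have q: "q \<ge> 1" using assms by simp
  have "u ^ 5 * (4 * q - u) \<le> q ^ 5 * (4 * q)"
    using assms by (intro mult_mono power_mono) auto
  also have "\<dots> \<le> 4 * q ^ 7"
    using power_increasing[of 6 7 q] q by (simp add: eval_nat_numeral)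
  finally have "u ^ 5 * (4 * q - u) / q ^ 7 \<le> 4"
    using q by (simp add: divide_le_eq)
  moreover have "0 \<le> u ^ 5 * (4 * q - u) / q ^ 7"
    using assms by (intro divide_nonneg_nonneg mult_nonneg_nonneg) auto
  moreover have "128 / u \<le> 128" "0 \<le> 128 / u"
    using assms by (auto simp: divide_le_eq)
  ultimately show ?thesis
    unfolding cert1_def by linarith
qed

lemma pochhammer_half_le_fact: "pochhammer (1/2) n \<le> (fact n :: real)"
  unfolding pochhammer_fact pochhammer_prod by (intro prod_mono) auto

text \<open>By \<open>(2n)! = 4^n (1/2)_n n!\<close>, five of the ten factors \<open>(1/2)_n\<close>
  cancel and \<open>4^5 = 1024\<close> appears.\<close>

lemma wz_term_0_right:
  "wz_term n 0 = (-1 / 1024) ^ n * (pochhammer (1/2) n ^ 5 / pochhammer 1 n ^ 5)"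
proof -
  have "pochhammer (1/2) n > (0::real)" by (simp add: pochhammer_pos)
  moreover have "(-1 / 1024 :: real) ^ n = (-1) ^ n / (2 ^ (2 * n)) ^ 5"
  proof -
    have "((2::real) ^ (2 * n)) ^ 5 = (2 ^ (2 * 5)) ^ n"
      by (simp only: power_mult [symmetric] mult_ac)
    then show ?thesis by (simp only: power_divide) simp
  qed
  ultimately show ?thesis
    unfolding wz_term_def mult_0_right add_0_right fact_double pochhammer_fact [symmetric]
    by (simp add: power_mult_distrib divide_simps) (simp add: eval_nat_numeral)
qed

text \<open>The weight \<open>q^2\<close> is the growth of the certificates. At \<open>k = 0\<close>
  the term is at most \<open>1024^(-n)\<close> and the weight at most \<open>9^n\<close>; the
  weighted term does not grow with \<open>k\<close>.\<close>

lemma abs_wz_term_le: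
  "\<bar>wz_term n k\<bar> * (2 * real n + real k + 1)^2 \<le> (9 / 1024) ^ n"
proof (induction k)
  case 0
  have p: "0 \<le> pochhammer (1/2) n / (pochhammer 1 n :: real)" "pochhammer (1/2) n / (pochhammer 1 n :: real) \<le> 1"
    using pochhammer_half_le_fact[of n] by (simp_all add: pochhammer_nonneg pochhammer_pos flip: pochhammer_fact)
  then have "(pochhammer (1/2) n / (pochhammer 1 n :: real)) ^ 5 \<le> 1"
    by (intro power_le_one)
  then have "\<bar>wz_term n 0\<bar> \<le> (1 / 1024) ^ n"
    using p unfolding wz_term_0_right
    by (simp add: abs_mult power_abs pochhammer_nonneg pochhammer_pos mult_left_le flip: power_divide)
  moreover have "2 * real n + 1 \<le> 3 ^ n"
    by (induction n) auto
  then have "(2 * real n + 1)^2 \<le> (3 ^ n)^2"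
    by (intro power_mono) auto
  ultimately have "\<bar>wz_term n 0\<bar> * (2 * real n + 1)^2 \<le> (1 / 1024) ^ n * (3 ^ n)^2"
    by (intro mult_mono) auto
  also have "\<dots> = (9 / 1024) ^ n"
  proof -
    have "((3::real) ^ n)^2 = (3^2) ^ n"
      by (simp only: power_mult [symmetric] mult.commute)
    then show ?thesis by (simp add: power_divide)
  qed
  finally show ?case by simp
next
  case (Suc k)
  define q where "q = 2 * real n + real k + 1"
  have q: "q \<ge> 1" by (simp add: q_def)
  have "(2 * real n + 2 * real k + 1) ^ 4 \<le> (2 * q - 1) ^ 4"
    by (intro power_mono) (auto simp: q_def)
  \<comment> \<open>Square of the cubic inequality \<open>(2q-1)^2 (q+1) \<le> 4 q^3\<close>, which
    bounds the ratio of consecutive weighted terms by 1.\<close>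
  moreover have "((2 * q - 1)^2 * (q + 1))\<^sup>2 \<le> (4 * q ^ 3)\<^sup>2"
  proof (rule power_mono)
    have "(2 * q - 1)^2 * (q + 1) = 4 * q ^ 3 - (3 * q - 1)" by algebra
    then show "(2 * q - 1)^2 * (q + 1) \<le> 4 * q ^ 3" using q by simp
  qed (use q in simp)
  then have "(2 * q - 1) ^ 4 * (q + 1)^2 \<le> 16 * q ^ 4 * q^2"
  proof -
    have "((2 * q - 1)^2 * (q + 1))\<^sup>2 = (2 * q - 1) ^ 4 * (q + 1)^2" "(4 * q ^ 3)\<^sup>2 = 16 * q ^ 4 * q^2"
      by algebra+
    then show ?thesis using \<open>((2 * q - 1)^2 * (q + 1))\<^sup>2 \<le> (4 * q ^ 3)\<^sup>2\<close> by (simp only:)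
  qed
  ultimately have "(2 * real n + 2 * real k + 1) ^ 4 * (q + 1)^2 \<le> 16 * q ^ 4 * q^2"
    by (meson mult_right_mono order_trans zero_le_power2)
  then have "(2 * real n + 2 * real k + 1) ^ 4 / (16 * q ^ 4) * (q + 1)^2 \<le> q^2"
    using q by (simp add: divide_le_eq mult_ac)
  then have "\<bar>wz_term n k\<bar> * ((2 * real n + 2 * real k + 1) ^ 4 / (16 * q ^ 4) * (q + 1)^2) \<le> \<bar>wz_term n k\<bar> * q^2"
    by (intro mult_left_mono) auto
  also have "\<dots> \<le> (9 / 1024) ^ n"
    using Suc by (simp only: q_def)
  finally have "\<bar>wz_term n k\<bar> * ((2 * real n + 2 * real k + 1) ^ 4 / (16 * q ^ 4) * (q + 1)^2) \<le> (9 / 1024) ^ n" .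
  moreover have "2 * real n + real (Suc k) + 1 = q + 1" by (simp add: q_def)
  moreover have "\<bar>wz_term n (Suc k)\<bar> = \<bar>wz_term n k\<bar> * ((2 * real n + 2 * real k + 1) ^ 4 / (16 * q ^ 4))"
    unfolding wz_term_Suc_right q_def abs_mult by simp
  ultimately show ?case
    by (simp only: mult.assoc)
qed

text \<open>The weighted term is kept because it serves twice: for a majorant geometric in
  \<open>n\<close>, and for the limit in \<open>k\<close> at fixed \<open>n \<ge> 1\<close>. Here
  \<open>2304 = 256 * 9\<close>.\<close>

lemma abs_wz_G_le_wz_term:
  "\<bar>wz_G n k\<bar> \<le> \<bar>wz_term n k\<bar> * (2 * real n + real k + 1)^2 * (2304 * zeta_nat 3 + 128)"
proof -
  define u where "u = 2 * real n + 1"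
  define q where "q = 2 * real n + real k + 1"
  have uq: "1 \<le> u" "u \<le> q" by (simp_all add: u_def q_def)
  then have "1 \<le> q^2" by (simp add: one_le_power)
  have "\<bar>cert0 u q * wz_harm n k + cert1 u q\<bar> \<le> \<bar>cert0 u q\<bar> * \<bar>wz_harm n k\<bar> + \<bar>cert1 u q\<bar>"
    by (metis abs_mult abs_triangle_ineq)
  also have "\<dots> \<le> 256 * q^2 * (9 * zeta_nat 3) + 128"
    using abs_cert0_le[OF uq] abs_cert1_le[OF uq] abs_wz_harm_le[of n k]
    by (intro add_mono mult_mono) auto
  also have "\<dots> \<le> q^2 * (2304 * zeta_nat 3 + 128)"
    using \<open>1 \<le> q^2\<close> by (simp add: algebra_simps)
  finally show ?thesis
    unfolding wz_G_def Let_def u_def [symmetric] q_def [symmetric]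
    by (simp add: abs_mult mult_left_mono mult.assoc)
qed

lemma abs_wz_G_le: "\<bar>wz_G n k\<bar> \<le> (9 / 1024) ^ n * (2304 * zeta_nat 3 + 128)"
proof -
  have "0 \<le> zeta_nat 3"
    using gen_harm_le_zeta_nat[of 3 0] by (simp add: gen_harm_def)
  then show ?thesis
    by (intro order_trans[OF abs_wz_G_le_wz_term] mult_right_mono abs_wz_term_le) auto
qed

lemma abs_wz_F_le: "\<bar>wz_F n k\<bar> \<le> (9 / 1024) ^ n * (2304 * zeta_nat 3)"
proof -
  define u where "u = 2 * real n + 1"
  define q where "q = 2 * real n + real k + 1"
  have uq: "1 \<le> u" "u \<le> q" by (simp_all add: u_def q_def)
  have "\<bar>wz_F n k\<bar> = \<bar>wz_term n k\<bar> * (64 * (\<bar>u - 1\<bar> * \<bar>4 * q - u - 2\<bar>)) * \<bar>wz_harm n k\<bar>"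
    by (simp add: wz_F_def u_def q_def Let_def abs_mult)
  also have "\<dots> \<le> \<bar>wz_term n k\<bar> * (64 * (q * (4 * q))) * (9 * zeta_nat 3)"
    using uq abs_wz_harm_le[of n k] by (intro mult_mono) auto
  also have "\<dots> = \<bar>wz_term n k\<bar> * q^2 * (2304 * zeta_nat 3)"
    by (simp add: power2_eq_square)
  also have "\<dots> \<le> (9 / 1024) ^ n * (2304 * zeta_nat 3)"
    using gen_harm_le_zeta_nat[of 3 0] abs_wz_term_le[of n k]
    by (intro mult_right_mono) (auto simp: gen_harm_def q_def)
  finally show ?thesis .
qed

section \<open>Summation over n and the value at k = 0\<close>

lemma summable_wz_G: "summable (\<lambda>n. wz_G n k)"
proof (rule summable_comparison_test')
  show "summable (\<lambda>n. (9 / 1024 :: real) ^ n * (2304 * zeta_nat 3 + 128))"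
    by (intro summable_mult2 summable_geometric) simp
qed (simp add: abs_wz_G_le)

lemma suminf_wz_G_Suc: "(\<Sum>n. wz_G n (Suc k)) = (\<Sum>n. wz_G n k)"
proof -
  have "(\<lambda>n. (9 / 1024) ^ n * (2304 * zeta_nat 3)) \<longlonglongrightarrow> 0"
    by (intro tendsto_mult_left_zero LIMSEQ_power_zero) simp
  then have "(\<lambda>n. wz_F n k) \<longlonglongrightarrow> 0"
    by (rule Lim_null_comparison[rotated]) (intro always_eventually allI, unfold real_norm_def, rule abs_wz_F_le)
  then have "(\<lambda>n. wz_F n k - wz_F (Suc n) k) sums (wz_F 0 k - 0)"
    by (rule telescope_sums')
  \<comment> \<open>The factor \<open>u - 1 = 2n\<close> vanishes.\<close>
  moreover have "wz_F 0 k = 0" by (simp add: wz_F_def)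
  ultimately have "(\<lambda>n. wz_G n k - wz_G n (Suc k)) sums 0"
    by (simp add: wz_pair)
  then show ?thesis
    using suminf_diff[OF summable_wz_G[of k] summable_wz_G[of "Suc k"]] by (simp add: sums_iff)
qed

lemma suminf_wz_G: "(\<Sum>n. wz_G n k) = (\<Sum>n. wz_G n 0)"
  by (induction k) (simp_all add: suminf_wz_G_Suc)

text \<open>At \<open>k = 0\<close> one has \<open>q = u\<close>, so the fractions collapse to
  \<open>3 u^2\<close> and \<open>3 / u\<close>; hence \<open>125 = 128 - 3\<close>.\<close>

lemma wz_G_0_right:
  "wz_G n 0 = (-1 / 1024) ^ n * (pochhammer (1/2) n ^ 5 / pochhammer 1 n ^ 5) *
     ((820 * (real n)^2 + 180 * real n + 13) * (9 * gen_harm 3 (2 * n) - gen_harm 3 n)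
        + 125 / (2 * real n + 1))"
proof -
  define u where "u = 2 * real n + 1"
  have u: "u \<noteq> 0" by (simp add: u_def add_nonneg_eq_0_iff)
  have c0: "cert0 u u = 820 * (real n)^2 + 180 * real n + 13"
  proof -
    have "u ^ 5 * (4 * u - u) / u ^ 4 = 3 * u^2"
      using u by (simp add: field_simps eval_nat_numeral)
    then show ?thesis
      unfolding cert0_def by (simp add: u_def power2_eq_square algebra_simps)
  qed
  have c1: "cert1 u u = 125 / u"
    using u by (simp add: cert1_def field_simps eval_nat_numeral)
  have "wz_harm n 0 = 9 * gen_harm 3 (2 * n) - gen_harm 3 n"
    by (simp add: wz_harm_def)
  then show ?thesis
    using c0 c1 unfolding wz_G_def Let_def wz_term_0_right by (simp add: u_def)
qed

section \<open>The limit k to infinity\<close>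

text \<open>For \<open>n \<ge> 1\<close>, \<open>(2n+k)!\<close> contains the extra factor
  \<open>m = n+k+1\<close> over \<open>(n+k)!\<close>; its fourth power beats the weight, which is
  at most \<open>4 m^2\<close>.\<close>

lemma wz_term_tendsto_0:
  assumes "n \<ge> 1"
  shows "(\<lambda>k. \<bar>wz_term n k\<bar> * (2 * real n + real k + 1)^2) \<longlonglongrightarrow> 0"
proof (rule Lim_null_comparison)
  define c :: real where "c = pochhammer (1/2) n ^ 6 / fact (2 * n)"
  have c: "c \<ge> 0" by (simp add: c_def pochhammer_nonneg)
  show "(\<lambda>k. 4 * c * inverse (real (Suc k))) \<longlonglongrightarrow> 0"
    by (intro tendsto_mult_right_zero LIMSEQ_inverse_real_of_nat)
  show "\<forall>\<^sub>F k in sequentially. norm (\<bar>wz_term n k\<bar> * (2 * real n + real k + 1)^2) \<le> 4 * c * inverse (real (Suc k))"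
  proof (intro always_eventually allI)
    fix k
    define m where "m = real n + real k + 1"
    have m: "m \<ge> 1" by (simp add: m_def)
    have "fact (n + k) * m = fact (Suc (n + k))"
      by (simp add: m_def algebra_simps)
    also have "\<dots> \<le> fact (2 * n + k)"
      using assms by (intro fact_mono) simp
    finally have "pochhammer (1/2) (n + k) * m \<le> fact (2 * n + k)"
      using mult_right_mono[OF pochhammer_half_le_fact[of "n + k"], of m] m by linarith
    then have "pochhammer (1/2) (n + k) / fact (2 * n + k) \<le> 1 / m"
      using m by (simp add: field_simps)
    then have "(pochhammer (1/2) (n + k) / fact (2 * n + k)) ^ 4 \<le> (1 / m) ^ 4"
      by (intro power_mono) (simp_all add: pochhammer_nonneg)
    moreover have "(2 * real n + real k + 1)^2 \<le> (2 * m)^2"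
      by (intro power_mono) (auto simp: m_def)
    ultimately have "(pochhammer (1/2) (n + k) / fact (2 * n + k)) ^ 4 * c * (2 * real n + real k + 1)^2
        \<le> (1 / m) ^ 4 * c * (2 * m)^2"
      using c by (intro mult_mono) auto
    also have "\<dots> = 4 * c * (1 / m^2)"
      using m by (simp add: field_simps eval_nat_numeral)
    also have "real (Suc k) \<le> m^2"
      using m power_increasing[of 1 2 m] by (simp add: m_def)
    then have "1 / m^2 \<le> inverse (real (Suc k))"
      using m by (simp add: field_simps)
    then have "4 * c * (1 / m^2) \<le> 4 * c * inverse (real (Suc k))"
      using c by (intro mult_left_mono) auto
    also have "(pochhammer (1/2) (n + k) / fact (2 * n + k)) ^ 4 * c = \<bar>wz_term n k\<bar>"
      by (simp add: wz_term_def c_def abs_mult power_divide pochhammer_nonneg power_abs)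
    finally show "norm (\<bar>wz_term n k\<bar> * (2 * real n + real k + 1)^2) \<le> 4 * c * inverse (real (Suc k))"
      by simp
  qed
qed

text \<open>\<open>Gamma_series' (1/2) k\<close> is \<open>(k-1)! sqrt k / (1/2)_k\<close> and tends
  to \<open>Gamma (1/2) = sqrt pi\<close>; take the inverse square.\<close>

lemma pochhammer_half_asymp:
  "(\<lambda>k. (pochhammer (1/2) k / fact k)^2 * real k) \<longlonglongrightarrow> 1 / pi"
proof -
  have "(\<lambda>k. 1 / (Gamma_series' (1/2) k)^2) \<longlonglongrightarrow> 1 / (Gamma (1/2 :: real))^2"
    by (intro tendsto_intros Gamma_series'_LIMSEQ) (simp add: Gamma_one_half_real)
  moreover have "1 / (Gamma_series' (1/2) k)^2 = (pochhammer (1/2) k / fact k)^2 * real k" if "k > 0" for k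
  proof -
    have "(exp (1/2 * ln (real k)))^2 = real k"
      using that by (simp flip: exp_of_nat_mult)
    moreover have "fact k = real k * fact (k - 1)"
      using that by (simp add: fact_reduce)
    ultimately show ?thesis
      using that by (simp add: Gamma_series'_def power_mult_distrib power_divide power2_eq_square)
  qed
  then have "\<forall>\<^sub>F k in sequentially. 1 / (Gamma_series' (1/2) k)^2 = (pochhammer (1/2) k / fact k)^2 * real k"
    using eventually_gt_at_top[of 0] by (rule eventually_mono[rotated])
  ultimately have "(\<lambda>k. (pochhammer (1/2) k / fact k)^2 * real k) \<longlonglongrightarrow> 1 / (Gamma (1/2 :: real))^2"
    by (rule Lim_transform_eventually)
  then show ?thesis
    by (simp add: Gamma_one_half_real)
qed

lemma wz_G_0_tendsto: "(\<lambda>k. wz_G 0 k) \<longlonglongrightarrow> 1024 * zeta_nat 3 / pi^2"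
proof -
  let ?a = "\<lambda>k. (pochhammer (1/2) k / fact k)^2 * real k"
  \<comment> \<open>\<open>wz_term 0 k\<close> is \<open>?a k ^ 2 / k^2\<close> for
    \<open>k > 0\<close>; the \<open>k^2\<close> is moved under the certificates. The limit 128 is
    \<open>16 * 8\<close>, and \<open>128 * 8 = 1024\<close>.\<close>
  have "(\<lambda>k. cert0 1 (real k + 1) / real k ^ 2) \<longlonglongrightarrow> 128"
    unfolding cert0_def by real_asymp
  moreover have "(\<lambda>k. cert1 1 (real k + 1) / real k ^ 2) \<longlonglongrightarrow> 0"
    unfolding cert1_def by real_asymp
  ultimately have "(\<lambda>k. (?a k)^2 * (cert0 1 (real k + 1) / real k ^ 2 * wz_harm 0 k + cert1 1 (real k + 1) / real k ^ 2))
      \<longlonglongrightarrow> (1 / pi)^2 * (128 * (8 * zeta_nat 3) + 0)"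
    by (intro tendsto_intros pochhammer_half_asymp wz_harm_0_tendsto)
  moreover have "(?a k)^2 * (cert0 1 (real k + 1) / real k ^ 2 * wz_harm 0 k + cert1 1 (real k + 1) / real k ^ 2) = wz_G 0 k"
    if "k > 0" for k
    using that by (simp add: wz_G_def Let_def wz_term_def power_mult_distrib power_divide field_simps)
  then have "\<forall>\<^sub>F k in sequentially. (?a k)^2 * (cert0 1 (real k + 1) / real k ^ 2 * wz_harm 0 k + cert1 1 (real k + 1) / real k ^ 2) = wz_G 0 k"
    using eventually_gt_at_top[of 0] by (rule eventually_mono[rotated])
  ultimately have "wz_G 0 \<longlonglongrightarrow> (1 / pi)^2 * (128 * (8 * zeta_nat 3) + 0)"
    by (rule Lim_transform_eventually)
  then show ?thesis
    by (simp add: power_divide)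
qed

lemma wz_G_tendsto:
  "(\<lambda>k. wz_G n k) \<longlonglongrightarrow> (if n = 0 then 1024 * zeta_nat 3 / pi^2 else 0)"
proof (cases "n = 0")
  case False
  have "(\<lambda>k. \<bar>wz_term n k\<bar> * (2 * real n + real k + 1)^2 * (2304 * zeta_nat 3 + 128)) \<longlonglongrightarrow> 0"
    using False by (intro tendsto_mult_left_zero wz_term_tendsto_0) simp
  then have "(\<lambda>k. wz_G n k) \<longlonglongrightarrow> 0"
    by (rule Lim_null_comparison[rotated]) (intro always_eventually allI, unfold real_norm_def, rule abs_wz_G_le_wz_term)
  with False show ?thesis by simp
qed (simp add: wz_G_0_tendsto)

text \<open>Tannery's theorem exchanges sum and limit, with the majorant \<open>abs_wz_G_le\<close>;
  the sums are constant in \<open>k\<close>, so they equal their limit.\<close>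

lemma suminf_wz_G_0: "(\<Sum>n. wz_G n 0) = 1024 * zeta_nat 3 / pi^2"
proof -
  have "(\<lambda>k. \<Sum>n. wz_G n k) \<longlonglongrightarrow> (\<Sum>n. if n = 0 then 1024 * zeta_nat 3 / pi^2 else 0)"
  proof (rule tannerys_theorem[THEN conjunct2, THEN conjunct2])
    show "\<forall>\<^sub>F (n, k) in at_top \<times>\<^sub>F at_top. norm (wz_G n k) \<le> (9 / 1024) ^ n * (2304 * zeta_nat 3 + 128)"
      unfolding real_norm_def by (intro always_eventually) (use abs_wz_G_le in blast)
    show "summable (\<lambda>n. (9 / 1024 :: real) ^ n * (2304 * zeta_nat 3 + 128))"
      by (intro summable_mult2 summable_geometric) simp
  qed (simp_all add: wz_G_tendsto)
  moreover have "(\<lambda>n. if n = 0 then 1024 * zeta_nat 3 / pi^2 else 0) sums (1024 * zeta_nat 3 / pi^2)"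
    using sums_single[of 0 "\<lambda>_. 1024 * zeta_nat 3 / pi^2"] by simp
  moreover have "(\<lambda>k. \<Sum>n. wz_G n k) = (\<lambda>k. \<Sum>n. wz_G n 0)"
    by (intro ext suminf_wz_G)
  ultimately show ?thesis
    by (simp add: sums_iff LIMSEQ_const_iff)
qed

theorem theorem1p4:
  shows "(\<lambda>k::nat. (-1 / 1024) ^ k * ((pochhammer (1/2) k) ^ 5 / (pochhammer 1 k) ^ 5) *
            ((820 * (real k)^2 + 180 * real k + 13) * (9 * gen_harm 3 (2 * k) - gen_harm 3 k)
             + 125 / (2 * real k + 1)))
         sums (1024 * zeta_nat 3 / pi^2)"
  using summable_wz_G[of 0] suminf_wz_G_0 unfolding wz_G_0_right sums_iff by blast

end
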